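(* Let $\theta$ be a substitution that is arity type preserving with respect to an arity context $\Theta$, and let $\Theta' = \mathrm{ctx}(\theta)\oplus\Theta$. (1) If $E$ is a canonical type or kind that respects $\Theta'$, then there is an $E'$ that respects $\Theta$ such that $[\theta]E=E'$ is derivable. (2) If $M$ is a canonical term such that $\Theta'\vdash M:\alpha$ is derivable, then there is an $M'$ such that $[\theta]M=M'$ and $\Theta\vdash M':\alpha$ are derivable. (3) If $R$ is an atomic term such that $\Theta'\vdash R\Rightarrow\alpha$ is derivable, then either there is an atomic term $R'$ such that $[\theta]_r R = R'$ and $\Theta\vdash R'\Rightarrow\alpha$ are derivable, or there is a canonical term $M$ such that $[\theta]_r R = M:\alpha$ and $\Theta\vdash M:\alpha$ are derivable.
   Context: Canonical LF syntax: kinds $K ::= \mathrm{Type} \mid \Pi x{:}A.K$; canonical types $A,B ::= P \mid \Pi x{:}A.B$; atomic types $P ::= a \mid P\,M$; canonical terms $M ::= R \mid \lambda x.M$; atomic terms $R ::= c \mid x \mid R\,M$ (up to renaming of bound variables). Arity types are generated from $o$ by $\rightarrow$; the erasure $A^-$ of a type is $P^-=o$, $(\Pi x{:}A_1.A_2)^-=A_1^-\rightarrow A_2^-$. A substitution is a finite set of triples $\langle x,M,\alpha\rangle$ with distinct variables; $\mathrm{ctx}(\theta)=\{x:\alpha \mid \langle x,M,\alpha\rangle\in\theta\}$. An arity context $\Theta$ is a set of unique assignments of arity types to constants and variables; $\Theta_1\oplus\Theta_2$ consists of all assignments of $\Theta_1$ plus those of $\Theta_2$ to symbols not assigned in $\Theta_1$.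 Arity typing: $\Theta\vdash c\Rightarrow\alpha$ if $c:\alpha\in\Theta$; $\Theta\vdash x\Rightarrow\alpha$ if $x:\alpha\in\Theta$; $\Theta\vdash R\,M\Rightarrow\alpha$ if $\Theta\vdash R\Rightarrow\alpha'\rightarrow\alpha$ and $\Theta\vdash M:\alpha'$; $\Theta\vdash\lambda x.M:\alpha_1\rightarrow\alpha_2$ if $\{x:\alpha_1\}\oplus\Theta\vdash M:\alpha_2$; $\Theta\vdash R:o$ if $\Theta\vdash R\Rightarrow o$. A kind or type $E$ respects $\Theta$ if $E$ is $\mathrm{Type}$; or $E$ is atomic and every canonical term in it has some arity type under $\Theta$; or $E=\Pi x{:}A.E'$ with $A$ respecting $\Theta$ and $E'$ respecting $\{x:A^-\}\oplus\Theta$. $\theta$ is arity type preserving w.r.t. $\Theta$ if $\Theta\vdash M:\alpha$ for each $\langle x,M,\alpha\rangle\in\theta$. Hereditary substitution ($[\theta]M=M'$, $[\theta]_rR=R'$, $[\theta]_rR=M':\alpha'$, and for types/kinds $[\theta]E=E'$) is the least relation closed under: $[\theta]R=R'$ if $[\theta]_rR=R'$; $[\theta]R=M'$ if $[\theta]_rR=M':\alpha'$; $[\theta](\lambda x.M)=\lambda x.M'$ if $x\notin\mathrm{dom}(\theta)$, $x$ not free in $\mathrm{rng}(\theta)$ and $[\theta]M=M'$; $[\theta]_rx=M:\alpha$ if $\langle x,M,\alpha\rangle\in\theta$; $[\theta]_r(R\,M)=M''':\alpha''$ if $[\theta]_rR=\lambda x.M':\alpha'\rightarrow\alpha''$, $[\theta]M=M''$,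 $[\{\langle x,M'',\alpha'\rangle\}]M'=M'''$; $[\theta]_rc=c$; $[\theta]_rx=x$ if $x\notin\mathrm{dom}(\theta)$; $[\theta]_r(R\,M)=R'\,M'$ if $[\theta]_rR=R'$, $[\theta]M=M'$; $[\theta]a=a$; $[\theta](P\,M)=P'\,M'$ if $[\theta]P=P'$, $[\theta]M=M'$; $[\theta](\Pi x{:}A_1.A_2)=\Pi x{:}A_1'.A_2'$ with $x$ fresh for $\theta$, $[\theta]A_1=A_1'$, $[\theta]A_2=A_2'$; $[\theta]\mathrm{Type}=\mathrm{Type}$ and the analogous $\Pi$ rule for kinds. *)

theory Defs
  imports Main
begin

text \<open>
  Expressions up to renaming of bound variables are represented locally nameless: free
  variables carry names (natural numbers), bound variables are de Bruijn indices. The named binders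
  of the paper are recovered by the operations \<open>lam\<close>, \<open>tpi\<close> and \<open>kpi\<close> below, which bind the
  free occurrences of a name; all rules are stated in terms of these. No rule applies to a
  \<open>Bnd\<close> leaf, so an expression with a dangling index is never well typed, never
  respects a context and is never the argument of a hereditary substitution.
\<close>

type_synonym var = nat

datatype arity = Base (\<open>\<o>\<close>) | Arr arity arity (infixr \<open>\<rightarrow>\<close> 65)

datatype 'c ctm = Atm "'c atm" | Lam "'c ctm"
  and 'c atm = Con 'c | Var var | Bnd nat | App "'c atm" "'c ctm"

datatype ('a, 'c) aty = TCon 'a | TApp "('a, 'c) aty" "'c ctm"

datatype ('a, 'c) cty = ATy "('a, 'c) aty" | Pi "('a, 'c) cty" "('a, 'c) cty"

datatype ('a, 'c) kind = Type | KPi "('a, 'c) cty" "('a, 'c) kind"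

primrec fv_ctm :: "'c ctm \<Rightarrow> var set" and fv_atm :: "'c atm \<Rightarrow> var set" where
  "fv_ctm (Atm R) = fv_atm R"
| "fv_ctm (Lam M) = fv_ctm M"
| "fv_atm (Con c) = {}"
| "fv_atm (Var x) = {x}"
| "fv_atm (Bnd i) = {}"
| "fv_atm (App R M) = fv_atm R \<union> fv_ctm M"

text \<open>\<open>close k x\<close> turns the free occurrences of \<open>x\<close> into references to the binder
  \<open>k\<close> levels further out.\<close>

primrec close_ctm :: "nat \<Rightarrow> var \<Rightarrow> 'c ctm \<Rightarrow> 'c ctm"
    and close_atm :: "nat \<Rightarrow> var \<Rightarrow> 'c atm \<Rightarrow> 'c atm" where
  "close_ctm k x (Atm R) = Atm (close_atm k x R)"
| "close_ctm k x (Lam M) = Lam (close_ctm (Suc k) x M)"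
| "close_atm k x (Con c) = Con c"
| "close_atm k x (Var y) = (if y = x then Bnd k else Var y)"
| "close_atm k x (Bnd i) = Bnd i"
| "close_atm k x (App R M) = App (close_atm k x R) (close_ctm k x M)"

primrec close_aty :: "nat \<Rightarrow> var \<Rightarrow> ('a, 'c) aty \<Rightarrow> ('a, 'c) aty" where
  "close_aty k x (TCon a) = TCon a"
| "close_aty k x (TApp P M) = TApp (close_aty k x P) (close_ctm k x M)"

primrec close_cty :: "nat \<Rightarrow> var \<Rightarrow> ('a, 'c) cty \<Rightarrow> ('a, 'c) cty" where
  "close_cty k x (ATy P) = ATy (close_aty k x P)"
| "close_cty k x (Pi A B) = Pi (close_cty k x A) (close_cty (Suc k) x B)"

primrec close_kind :: "nat \<Rightarrow> var \<Rightarrow> ('a, 'c) kind \<Rightarrow> ('a, 'c) kind" where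
  "close_kind k x Type = Type"
| "close_kind k x (KPi A K) = KPi (close_cty k x A) (close_kind (Suc k) x K)"

definition lam :: "var \<Rightarrow> 'c ctm \<Rightarrow> 'c ctm" where
  "lam x M = Lam (close_ctm 0 x M)"

definition tpi :: "var \<Rightarrow> ('a, 'c) cty \<Rightarrow> ('a, 'c) cty \<Rightarrow> ('a, 'c) cty" where
  "tpi x A B = Pi A (close_cty 0 x B)"

definition kpi :: "var \<Rightarrow> ('a, 'c) cty \<Rightarrow> ('a, 'c) kind \<Rightarrow> ('a, 'c) kind" where
  "kpi x A K = KPi A (close_kind 0 x K)"

primrec erase :: "('a, 'c) cty \<Rightarrow> arity" where
  "erase (ATy P) = \<o>"
| "erase (Pi A B) = erase A \<rightarrow> erase B"

datatype 'c sym = SCon 'c | SVar var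

type_synonym 'c actx = "('c sym \<times> arity) set"

definition arity_ctx :: "'c actx \<Rightarrow> bool" where
  "arity_ctx \<Theta> \<longleftrightarrow> single_valued \<Theta>"

definition oplus :: "'c actx \<Rightarrow> 'c actx \<Rightarrow> 'c actx" (infixr \<open>\<oplus>\<close> 65) where
  "\<Theta>\<^sub>1 \<oplus> \<Theta>\<^sub>2 = \<Theta>\<^sub>1 \<union> {(s, \<alpha>) \<in> \<Theta>\<^sub>2. s \<notin> Domain \<Theta>\<^sub>1}"

text \<open>\<open>synth \<Theta> R \<alpha>\<close> is the judgement $\Theta \vdash R \Rightarrow \alpha$ on atomic terms and
  \<open>check \<Theta> M \<alpha>\<close> is $\Theta \vdash M : \alpha$ on canonical terms.\<close>

inductive synth :: "'c actx \<Rightarrow> 'c atm \<Rightarrow> arity \<Rightarrow> bool"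
      and check :: "'c actx \<Rightarrow> 'c ctm \<Rightarrow> arity \<Rightarrow> bool" where
  synth_Con: "(SCon c, \<alpha>) \<in> \<Theta> \<Longrightarrow> synth \<Theta> (Con c) \<alpha>"
| synth_Var: "(SVar x, \<alpha>) \<in> \<Theta> \<Longrightarrow> synth \<Theta> (Var x) \<alpha>"
| synth_App: "synth \<Theta> R (\<alpha>' \<rightarrow> \<alpha>) \<Longrightarrow> check \<Theta> M \<alpha>' \<Longrightarrow> synth \<Theta> (App R M) \<alpha>"
| check_lam: "check ({(SVar x, \<alpha>\<^sub>1)} \<oplus> \<Theta>) M \<alpha>\<^sub>2 \<Longrightarrow> check \<Theta> (lam x M) (\<alpha>\<^sub>1 \<rightarrow> \<alpha>\<^sub>2)"
| check_Atm: "synth \<Theta> R \<o> \<Longrightarrow> check \<Theta> (Atm R) \<o>"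

text \<open>The canonical terms in an atomic type $a\,M_1 \ldots M_n$ are its arguments $M_i$; their subterms
  under binders are typed in extended contexts and so are covered by the typing of $M_i$.\<close>

primrec args :: "('a, 'c) aty \<Rightarrow> 'c ctm set" where
  "args (TCon a) = {}"
| "args (TApp P M) = insert M (args P)"

inductive respects_ty :: "'c actx \<Rightarrow> ('a, 'c) cty \<Rightarrow> bool" where
  respects_ATy: "(\<forall>M \<in> args P. \<exists>\<alpha>. check \<Theta> M \<alpha>) \<Longrightarrow> respects_ty \<Theta> (ATy P)"
| respects_pi: "respects_ty \<Theta> A \<Longrightarrow> respects_ty ({(SVar x, erase A)} \<oplus> \<Theta>) B \<Longrightarrow>
    respects_ty \<Theta> (tpi x A B)"

inductive respects_kind :: "'c actx \<Rightarrow> ('a, 'c) kind \<Rightarrow> bool" where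
  respects_Type: "respects_kind \<Theta> Type"
| respects_kpi: "respects_ty \<Theta> A \<Longrightarrow> respects_kind ({(SVar x, erase A)} \<oplus> \<Theta>) K \<Longrightarrow>
    respects_kind \<Theta> (kpi x A K)"

type_synonym 'c subst = "(var \<times> 'c ctm \<times> arity) set"

definition is_subst :: "'c subst \<Rightarrow> bool" where
  "is_subst \<theta> \<longleftrightarrow> finite \<theta> \<and> inj_on fst \<theta>"

definition sdom :: "'c subst \<Rightarrow> var set" where
  "sdom \<theta> = {x. \<exists>M \<alpha>. (x, M, \<alpha>) \<in> \<theta>}"

definition fv_rng :: "'c subst \<Rightarrow> var set" where
  "fv_rng \<theta> = {y. \<exists>x M \<alpha>. (x, M, \<alpha>) \<in> \<theta> \<and> y \<in> fv_ctm M}"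

definition fresh_for :: "var \<Rightarrow> 'c subst \<Rightarrow> bool" where
  "fresh_for x \<theta> \<longleftrightarrow> x \<notin> sdom \<theta> \<and> x \<notin> fv_rng \<theta>"

definition subst_ctx :: "'c subst \<Rightarrow> 'c actx" where
  "subst_ctx \<theta> = {(SVar x, \<alpha>) | x \<alpha>. \<exists>M. (x, M, \<alpha>) \<in> \<theta>}"

definition arity_preserving :: "'c actx \<Rightarrow> 'c subst \<Rightarrow> bool" where
  "arity_preserving \<Theta> \<theta> \<longleftrightarrow> (\<forall>x M \<alpha>. (x, M, \<alpha>) \<in> \<theta> \<longrightarrow> check \<Theta> M \<alpha>)"

text \<open>\<open>hsub \<theta> M M'\<close> is $[\theta]M = M'$, \<open>hsub_rr \<theta> R R'\<close> is $[\theta]_r R = R'$, and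
  \<open>hsub_rm \<theta> R M \<alpha>\<close> is $[\theta]_r R = M : \alpha$.\<close>

inductive hsub :: "'c subst \<Rightarrow> 'c ctm \<Rightarrow> 'c ctm \<Rightarrow> bool"
      and hsub_rr :: "'c subst \<Rightarrow> 'c atm \<Rightarrow> 'c atm \<Rightarrow> bool"
      and hsub_rm :: "'c subst \<Rightarrow> 'c atm \<Rightarrow> 'c ctm \<Rightarrow> arity \<Rightarrow> bool" where
  hsub_Atm_r: "hsub_rr \<theta> R R' \<Longrightarrow> hsub \<theta> (Atm R) (Atm R')"
| hsub_Atm_m: "hsub_rm \<theta> R M' \<alpha>' \<Longrightarrow> hsub \<theta> (Atm R) M'"
| hsub_lam: "fresh_for x \<theta> \<Longrightarrow> hsub \<theta> M M' \<Longrightarrow> hsub \<theta> (lam x M) (lam x M')"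
| hsub_rm_Var: "(x, M, \<alpha>) \<in> \<theta> \<Longrightarrow> hsub_rm \<theta> (Var x) M \<alpha>"
| hsub_rm_App: "hsub_rm \<theta> R (lam x M') (\<alpha>' \<rightarrow> \<alpha>'') \<Longrightarrow> hsub \<theta> M M'' \<Longrightarrow>
    hsub {(x, M'', \<alpha>')} M' M''' \<Longrightarrow> hsub_rm \<theta> (App R M) M''' \<alpha>''"
| hsub_rr_Con: "hsub_rr \<theta> (Con c) (Con c)"
| hsub_rr_Var: "x \<notin> sdom \<theta> \<Longrightarrow> hsub_rr \<theta> (Var x) (Var x)"
| hsub_rr_App: "hsub_rr \<theta> R R' \<Longrightarrow> hsub \<theta> M M' \<Longrightarrow> hsub_rr \<theta> (App R M) (App R' M')"

inductive hsub_aty :: "'c subst \<Rightarrow> ('a, 'c) aty \<Rightarrow> ('a, 'c) aty \<Rightarrow> bool" where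
  hsub_TCon: "hsub_aty \<theta> (TCon a) (TCon a)"
| hsub_TApp: "hsub_aty \<theta> P P' \<Longrightarrow> hsub \<theta> M M' \<Longrightarrow> hsub_aty \<theta> (TApp P M) (TApp P' M')"

inductive hsub_ty :: "'c subst \<Rightarrow> ('a, 'c) cty \<Rightarrow> ('a, 'c) cty \<Rightarrow> bool" where
  hsub_ATy: "hsub_aty \<theta> P P' \<Longrightarrow> hsub_ty \<theta> (ATy P) (ATy P')"
| hsub_pi: "fresh_for x \<theta> \<Longrightarrow> hsub_ty \<theta> A A' \<Longrightarrow> hsub_ty \<theta> B B' \<Longrightarrow>
    hsub_ty \<theta> (tpi x A B) (tpi x A' B')"

inductive hsub_kind :: "'c subst \<Rightarrow> ('a, 'c) kind \<Rightarrow> ('a, 'c) kind \<Rightarrow> bool" where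
  hsub_Type: "hsub_kind \<theta> Type Type"
| hsub_kpi: "fresh_for x \<theta> \<Longrightarrow> hsub_ty \<theta> A A' \<Longrightarrow> hsub_kind \<theta> K K' \<Longrightarrow>
    hsub_kind \<theta> (kpi x A K) (kpi x A' K')"

end

theory Submission
  imports Defs "HOL-Combinatorics.Transposition"
begin

text \<open>
  Totality of hereditary substitution is shown by an outer induction on a bound for the size of the
  arity types in the substitution and an inner induction on the size of the term. When the head of
  an atomic term is replaced, the arity type recorded for the result is a suffix of one occurring in
  the substitution; hence the redex created by an application is contracted by a substitution whose
  arity type is strictly smaller. At binders the bound variable is first renamed apart from the
  substitution.
\<close>

section \<open>Renaming of free variables\<close>

text \<open>Binders carry indices, so a renaming passes under them unchanged and nothing is
  captured. Applied to a named body before closing, it changes the name of the bound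
  variable.\<close>

primrec ren_ctm :: "(var \<Rightarrow> var) \<Rightarrow> 'c ctm \<Rightarrow> 'c ctm"
    and ren_atm :: "(var \<Rightarrow> var) \<Rightarrow> 'c atm \<Rightarrow> 'c atm" where
  "ren_ctm f (Atm R) = Atm (ren_atm f R)"
| "ren_ctm f (Lam M) = Lam (ren_ctm f M)"
| "ren_atm f (Con c) = Con c"
| "ren_atm f (Var x) = Var (f x)"
| "ren_atm f (Bnd i) = Bnd i"
| "ren_atm f (App R M) = App (ren_atm f R) (ren_ctm f M)"

primrec ren_aty :: "(var \<Rightarrow> var) \<Rightarrow> ('a, 'c) aty \<Rightarrow> ('a, 'c) aty" where
  "ren_aty f (TCon a) = TCon a"
| "ren_aty f (TApp P M) = TApp (ren_aty f P) (ren_ctm f M)"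

primrec ren_cty :: "(var \<Rightarrow> var) \<Rightarrow> ('a, 'c) cty \<Rightarrow> ('a, 'c) cty" where
  "ren_cty f (ATy P) = ATy (ren_aty f P)"
| "ren_cty f (Pi A B) = Pi (ren_cty f A) (ren_cty f B)"

primrec ren_kind :: "(var \<Rightarrow> var) \<Rightarrow> ('a, 'c) kind \<Rightarrow> ('a, 'c) kind" where
  "ren_kind f Type = Type"
| "ren_kind f (KPi A K) = KPi (ren_cty f A) (ren_kind f K)"

primrec fv_aty :: "('a, 'c) aty \<Rightarrow> var set" where
  "fv_aty (TCon a) = {}"
| "fv_aty (TApp P M) = fv_aty P \<union> fv_ctm M"

primrec fv_cty :: "('a, 'c) cty \<Rightarrow> var set" where
  "fv_cty (ATy P) = fv_aty P"
| "fv_cty (Pi A B) = fv_cty A \<union> fv_cty B"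

primrec fv_kind :: "('a, 'c) kind \<Rightarrow> var set" where
  "fv_kind Type = {}"
| "fv_kind (KPi A K) = fv_cty A \<union> fv_kind K"

lemma finite_fv_tm [simp]:
  fixes M :: "'c ctm" and R :: "'c atm"
  shows "finite (fv_ctm M)" "finite (fv_atm R)"
  by (induction M and R) auto

lemma finite_fv_aty [simp]: "finite (fv_aty P)"
  by (induction P) auto

lemma finite_fv_cty [simp]: "finite (fv_cty A)"
  by (induction A) auto

lemma finite_fv_kind [simp]: "finite (fv_kind K)"
  by (induction K) auto

lemma fv_close_tm [simp]:
  fixes M :: "'c ctm" and R :: "'c atm"
  shows "fv_ctm (close_ctm k x M) = fv_ctm M - {x}" "fv_atm (close_atm k x R) = fv_atm R - {x}"
  by (induction M and R arbitrary: k and k) auto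

lemma fv_close_aty [simp]: "fv_aty (close_aty k x P) = fv_aty P - {x}"
  by (induction P) auto

lemma fv_close_cty [simp]: "fv_cty (close_cty k x A) = fv_cty A - {x}"
  by (induction A arbitrary: k) auto

lemma fv_close_kind [simp]: "fv_kind (close_kind k x K) = fv_kind K - {x}"
  by (induction K arbitrary: k) auto

lemma fv_binders [simp]:
  "fv_ctm (lam x M) = fv_ctm M - {x}"
  "fv_cty (tpi x A B) = fv_cty A \<union> (fv_cty B - {x})"
  "fv_kind (kpi x A K) = fv_cty A \<union> (fv_kind K - {x})"
  by (simp_all add: lam_def tpi_def kpi_def)

text \<open>Used with transpositions: swapping a bound name with a fresh one leaves the closed
  expression as it is.\<close>

lemma ren_tm_ident:
  fixes M :: "'c ctm" and R :: "'c atm"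
  shows "(\<And>x. x \<in> fv_ctm M \<Longrightarrow> f x = x) \<Longrightarrow> ren_ctm f M = M"
    and "(\<And>x. x \<in> fv_atm R \<Longrightarrow> f x = x) \<Longrightarrow> ren_atm f R = R"
  by (induction M and R) auto

lemma ren_aty_ident: "(\<And>x. x \<in> fv_aty P \<Longrightarrow> f x = x) \<Longrightarrow> ren_aty f P = P"
  by (induction P) (auto intro: ren_tm_ident)

lemma ren_cty_ident: "(\<And>x. x \<in> fv_cty A \<Longrightarrow> f x = x) \<Longrightarrow> ren_cty f A = A"
  by (induction A) (auto intro: ren_aty_ident)

lemma ren_kind_ident: "(\<And>x. x \<in> fv_kind K \<Longrightarrow> f x = x) \<Longrightarrow> ren_kind f K = K"
  by (induction K) (auto intro: ren_cty_ident)

text \<open>Closing tests \<open>y = x\<close>, and injectivity makes this test agree with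
  \<open>f y = f x\<close>. A renaming that identified two names would let the binder catch a
  foreign variable.\<close>

lemma ren_close_tm:
  fixes M :: "'c ctm" and R :: "'c atm"
  assumes "inj f"
  shows "ren_ctm f (close_ctm k x M) = close_ctm k (f x) (ren_ctm f M)"
    and "ren_atm f (close_atm k x R) = close_atm k (f x) (ren_atm f R)"
  by (induction M and R arbitrary: k and k) (use assms in \<open>auto dest: injD\<close>)

lemma ren_close_aty:
  "inj f \<Longrightarrow> ren_aty f (close_aty k x P) = close_aty k (f x) (ren_aty f P)"
  by (induction P) (auto simp: ren_close_tm)

lemma ren_close_cty:
  "inj f \<Longrightarrow> ren_cty f (close_cty k x A) = close_cty k (f x) (ren_cty f A)"
  by (induction A arbitrary: k) (auto simp: ren_close_aty)

lemma ren_close_kind: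
  "inj f \<Longrightarrow> ren_kind f (close_kind k x K) = close_kind k (f x) (ren_kind f K)"
  by (induction K arbitrary: k) (auto simp: ren_close_cty)

lemma ren_binders:
  assumes "inj f"
  shows "ren_ctm f (lam x M) = lam (f x) (ren_ctm f M)"
    and "ren_cty f (tpi x A B) = tpi (f x) (ren_cty f A) (ren_cty f B)"
    and "ren_kind f (kpi x A K) = kpi (f x) (ren_cty f A) (ren_kind f K)"
  using assms by (simp_all add: lam_def tpi_def kpi_def ren_close_tm ren_close_cty ren_close_kind)

section \<open>Erasure, arguments and sizes under renaming and closing\<close>

lemma erase_close_cty [simp]: "erase (close_cty k x A) = erase A"
  by (induction A arbitrary: k) auto

lemma erase_ren_cty [simp]: "erase (ren_cty f A) = erase A"
  by (induction A) auto

lemma args_ren_aty: "args (ren_aty f P) = ren_ctm f ` args P"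
  by (induction P) auto

lemma fv_args: "M \<in> args P \<Longrightarrow> fv_ctm M \<subseteq> fv_aty P"
  by (induction P) auto

text \<open>A name and an index count the same. Hence a named body \<open>M\<close> is smaller than
  \<open>lam x M\<close> although it is not a subterm of it, which is why the later inductions run
  on size.\<close>

lemma size_close_tm [simp]:
  fixes M :: "'c ctm" and R :: "'c atm"
  shows "size (close_ctm k x M) = size M" "size (close_atm k x R) = size R"
  by (induction M and R arbitrary: k and k) auto

lemma size_close_cty [simp]: "size (close_cty k x A) = size A"
proof -
  have "size (close_aty k x P) = size P" for k and P :: "('a, 'c) aty"
    by (induction P) auto
  then show ?thesis
    by (induction A arbitrary: k) auto
qed

lemma size_close_kind [simp]: "size (close_kind k x K) = size K"
  by (induction K arbitrary: k) auto

section \<open>Contexts\<close>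

text \<open>Inclusion of contexts along \<open>f\<close>, asked only for the variables in
  \<open>X\<close>, in practice the free ones. Weakening and change of a bound name are both
  instances.\<close>

definition ctx_ren :: "(var \<Rightarrow> var) \<Rightarrow> var set \<Rightarrow> 'c actx \<Rightarrow> 'c actx \<Rightarrow> bool" where
  "ctx_ren f X \<Theta> \<Theta>' \<longleftrightarrow>
     (\<forall>c \<alpha>. (SCon c, \<alpha>) \<in> \<Theta> \<longrightarrow> (SCon c, \<alpha>) \<in> \<Theta>') \<and>
     (\<forall>x \<in> X. \<forall>\<alpha>. (SVar x, \<alpha>) \<in> \<Theta> \<longrightarrow> (SVar (f x), \<alpha>) \<in> \<Theta>')"

lemma ctx_ren_mono: "ctx_ren f X \<Theta> \<Theta>' \<Longrightarrow> Y \<subseteq> X \<Longrightarrow> ctx_ren f Y \<Theta> \<Theta>'"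
  by (auto simp: ctx_ren_def)

text \<open>The new assignment shadows any old one for \<open>x\<close>, so nothing is asked of
  \<open>x\<close> beforehand; injectivity keeps the other variables of \<open>X\<close> from being
  shadowed by \<open>f x\<close>.\<close>

lemma ctx_ren_bind:
  "inj f \<Longrightarrow> ctx_ren f (X - {x}) \<Theta> \<Theta>' \<Longrightarrow>
   ctx_ren f X ({(SVar x, \<alpha>)} \<oplus> \<Theta>) ({(SVar (f x), \<alpha>)} \<oplus> \<Theta>')"
  by (auto simp: ctx_ren_def oplus_def dest: injD)

lemma ctx_ren_weaken: "x \<notin> X \<Longrightarrow> ctx_ren id X \<Theta> ({(SVar x, \<alpha>)} \<oplus> \<Theta>)"
  by (auto simp: ctx_ren_def oplus_def)

text \<open>The swap sends \<open>y\<close> to \<open>x\<close>, whose assignment may be missing on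
  the right, so \<open>y\<close> must not be a further variable of \<open>X\<close>. The case
  \<open>y = x\<close> is allowed.\<close>

lemma ctx_ren_transpose:
  "y \<notin> X - {x} \<Longrightarrow>
   ctx_ren (transpose x y) X ({(SVar x, \<alpha>)} \<oplus> \<Theta>) ({(SVar y, \<alpha>)} \<oplus> \<Theta>)"
  by (auto simp: ctx_ren_def oplus_def transpose_def)

section \<open>Typing and respect are stable under injective renaming\<close>

lemma ren_typing:
  assumes "inj f"
  shows "synth \<Theta> R \<alpha> \<Longrightarrow> ctx_ren f (fv_atm R) \<Theta> \<Theta>' \<Longrightarrow> synth \<Theta>' (ren_atm f R) \<alpha>"
    and "check \<Theta> M \<alpha> \<Longrightarrow> ctx_ren f (fv_ctm M) \<Theta> \<Theta>' \<Longrightarrow> check \<Theta>' (ren_ctm f M) \<alpha>"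
proof (induction arbitrary: \<Theta>' and \<Theta>' rule: synth_check.inducts)
  case (check_lam x \<alpha>\<^sub>1 \<Theta> M \<alpha>\<^sub>2)
  then show ?case
    using assms by (simp add: ren_binders ctx_ren_bind synth_check.check_lam)
next
  case (synth_App \<Theta> R \<alpha>' \<alpha> M)
  then have "synth \<Theta>' (ren_atm f R) (\<alpha>' \<rightarrow> \<alpha>)" "check \<Theta>' (ren_ctm f M) \<alpha>'"
    by (simp_all add: ctx_ren_def)
  then show ?case
    by (simp add: synth_check.synth_App)
qed (auto simp: ctx_ren_def intro: synth_check.intros)

text \<open>Erasure ignores names, so the bound variable has the same arity type before and after
  the renaming.\<close>

lemma ren_respects_ty:
  assumes "inj f"
  shows "respects_ty \<Theta> A \<Longrightarrow> ctx_ren f (fv_cty A) \<Theta> \<Theta>' \<Longrightarrow> respects_ty \<Theta>' (ren_cty f A)"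
proof (induction arbitrary: \<Theta>' rule: respects_ty.induct)
  case (respects_ATy P \<Theta>)
  have "\<exists>\<alpha>. check \<Theta>' (ren_ctm f M) \<alpha>" if M: "M \<in> args P" for M
  proof -
    obtain \<alpha> where "check \<Theta> M \<alpha>"
      using respects_ATy(1) M by blast
    moreover have "ctx_ren f (fv_ctm M) \<Theta> \<Theta>'"
      by (rule ctx_ren_mono[OF respects_ATy(2)]) (simp add: fv_args[OF M])
    ultimately have "check \<Theta>' (ren_ctm f M) \<alpha>"
      by (rule ren_typing(2)[OF assms])
    then show ?thesis ..
  qed
  then show ?case
    by (simp add: args_ren_aty respects_ty.respects_ATy)
next
  case (respects_pi \<Theta> A x B)
  have "respects_ty \<Theta>' (ren_cty f A)"
    by (rule respects_pi.IH(1)[OF ctx_ren_mono[OF respects_pi.prems]]) simp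
  moreover have "respects_ty ({(SVar (f x), erase (ren_cty f A))} \<oplus> \<Theta>') (ren_cty f B)"
    unfolding erase_ren_cty
    by (rule respects_pi.IH(2)[OF ctx_ren_bind[OF assms ctx_ren_mono[OF respects_pi.prems]]]) auto
  ultimately show ?case
    unfolding ren_binders[OF assms] by (rule respects_ty.respects_pi)
qed

lemma ren_respects_kind:
  assumes "inj f"
  shows "respects_kind \<Theta> K \<Longrightarrow> ctx_ren f (fv_kind K) \<Theta> \<Theta>' \<Longrightarrow> respects_kind \<Theta>' (ren_kind f K)"
proof (induction arbitrary: \<Theta>' rule: respects_kind.induct)
  case (respects_Type \<Theta>)
  then show ?case
    by (simp add: respects_kind.respects_Type)
next
  case (respects_kpi \<Theta> A x K)
  have "respects_ty \<Theta>' (ren_cty f A)"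
    by (rule ren_respects_ty[OF assms respects_kpi.hyps(1) ctx_ren_mono[OF respects_kpi.prems]]) simp
  moreover have "respects_kind ({(SVar (f x), erase (ren_cty f A))} \<oplus> \<Theta>') (ren_kind f K)"
    unfolding erase_ren_cty
    by (rule respects_kpi.IH[OF ctx_ren_bind[OF assms ctx_ren_mono[OF respects_kpi.prems]]]) auto
  ultimately show ?case
    unfolding ren_binders[OF assms] by (rule respects_kind.respects_kpi)
qed

lemma check_weaken:
  assumes "check \<Theta> M \<alpha>" "x \<notin> fv_ctm M"
  shows "check ({(SVar x, \<beta>)} \<oplus> \<Theta>) M \<alpha>"
  using ren_typing(2)[OF inj_on_id assms(1) ctx_ren_weaken[OF assms(2)]] ren_tm_ident(1)[of M id]
  by simp

section \<open>Inversion with a fresh bound variable\<close>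

lemma ex_fresh: "finite X \<Longrightarrow> finite Y \<Longrightarrow> \<exists>y :: var. y \<notin> X \<and> y \<notin> Y"
  using ex_new_if_finite[OF infinite_UNIV_nat, of "X \<union> Y"] by auto

text \<open>Plain inversion yields whatever name the derivation used. Swapping it with a name
  outside \<open>X\<close> gives another named reading of the same abstraction, so the freshness
  condition of \<open>hsub_lam\<close> can be met.\<close>

lemma check_Lam_fresh:
  assumes "check \<Theta> (Lam N) \<alpha>" "finite X"
  obtains y M \<alpha>\<^sub>1 \<alpha>\<^sub>2 where "y \<notin> X" "Lam N = lam y M" "\<alpha> = \<alpha>\<^sub>1 \<rightarrow> \<alpha>\<^sub>2"
    "check ({(SVar y, \<alpha>\<^sub>1)} \<oplus> \<Theta>) M \<alpha>\<^sub>2"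
  using assms(1)
proof cases
  case (check_lam x \<alpha>\<^sub>1 M \<alpha>\<^sub>2)
  \<comment> \<open>Besides \<open>X\<close>, the name avoids the abstraction itself;
    \<open>x\<close> is not free there either, so the swap fixes \<open>Lam N\<close>.\<close>
  obtain y where y: "y \<notin> X" "y \<notin> fv_ctm (Lam N)"
    using ex_fresh[OF assms(2) finite_fv_tm(1)] by blast
  let ?f = "transpose x y"
  have "lam y (ren_ctm ?f M) = ren_ctm ?f (Lam N)"
    using check_lam(1) by (simp add: ren_binders)
  also have "\<dots> = Lam N"
    using y(2) unfolding check_lam(1) by (intro ren_tm_ident) (auto simp: transpose_def)
  finally have "Lam N = lam y (ren_ctm ?f M)" ..
  moreover have "check ({(SVar y, \<alpha>\<^sub>1)} \<oplus> \<Theta>) (ren_ctm ?f M) \<alpha>\<^sub>2"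
    using ren_typing(2)[OF _ check_lam(3) ctx_ren_transpose] y(2) check_lam(1) by simp
  ultimately show thesis
    using that y(1) check_lam(2) by blast
qed

text \<open>The same change of bound name as for abstractions. The domain lies outside the scope of
  the binder, so only the codomain is swapped.\<close>

lemma respects_Pi_fresh:
  assumes "respects_ty \<Theta> (Pi A C)" "finite X"
  obtains y B where "y \<notin> X" "Pi A C = tpi y A B" "respects_ty \<Theta> A"
    "respects_ty ({(SVar y, erase A)} \<oplus> \<Theta>) B"
  using assms(1)
proof cases
  case (respects_pi A' x B)
  then have C: "C = close_cty 0 x B" and A: "A' = A"
    by (simp_all add: tpi_def)
  obtain y where y: "y \<notin> X" "y \<notin> fv_cty C"
    using ex_fresh[OF assms(2) finite_fv_cty] by blast
  let ?f = "transpose x y"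
  have "close_cty 0 y (ren_cty ?f B) = ren_cty ?f C"
    by (simp add: C ren_close_cty)
  also have "\<dots> = C"
    using y(2) unfolding C by (intro ren_cty_ident) (auto simp: transpose_def)
  finally have "Pi A C = tpi y A (ren_cty ?f B)"
    by (simp add: tpi_def)
  moreover have "respects_ty ({(SVar y, erase A)} \<oplus> \<Theta>) (ren_cty ?f B)"
    using ren_respects_ty[OF _ respects_pi(3) ctx_ren_transpose] y(2) C A by simp
  ultimately show thesis
    using that y(1) respects_pi(2) A by blast
qed

lemma respects_KPi_fresh:
  assumes "respects_kind \<Theta> (KPi A C)" "finite X"
  obtains y K where "y \<notin> X" "KPi A C = kpi y A K" "respects_ty \<Theta> A"
    "respects_kind ({(SVar y, erase A)} \<oplus> \<Theta>) K"
  using assms(1)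
proof cases
  case (respects_kpi A' x K)
  then have C: "C = close_kind 0 x K" and A: "A' = A"
    by (simp_all add: kpi_def)
  obtain y where y: "y \<notin> X" "y \<notin> fv_kind C"
    using ex_fresh[OF assms(2) finite_fv_kind] by blast
  let ?f = "transpose x y"
  have "close_kind 0 y (ren_kind ?f K) = ren_kind ?f C"
    by (simp add: C ren_close_kind)
  also have "\<dots> = C"
    using y(2) unfolding C by (intro ren_kind_ident) (auto simp: transpose_def)
  finally have "KPi A C = kpi y A (ren_kind ?f K)"
    by (simp add: kpi_def)
  moreover have "respects_kind ({(SVar y, erase A)} \<oplus> \<Theta>) (ren_kind ?f K)"
    using ren_respects_kind[OF _ respects_kpi(3) ctx_ren_transpose] y(2) C A by simp
  ultimately show thesis
    using that y(1) respects_kpi(2) A by blast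
qed

section \<open>Hereditary substitution on terms\<close>

text \<open>Turns \<open>fresh_for\<close> into avoidance of a finite set, as the inversion lemmas
  require.\<close>

lemma finite_sdom_fv_rng:
  assumes "finite \<theta>"
  shows "finite (sdom \<theta> \<union> fv_rng \<theta>)"
proof -
  have "sdom \<theta> = fst ` \<theta>" "fv_rng \<theta> = (\<Union>(x, M, \<alpha>) \<in> \<theta>. fv_ctm M)"
    by (force simp: sdom_def fv_rng_def)+
  then show ?thesis
    using assms by auto
qed

lemma Domain_subst_ctx: "Domain (subst_ctx \<theta>) = SVar ` sdom \<theta>"
  by (auto simp: subst_ctx_def sdom_def)

text \<open>As \<open>x\<close> is outside the domain of \<theta>, neither context shadows the other
  and they may be exchanged. This brings the context of a body into the form that the induction
  hypotheses expect.\<close>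

lemma subst_ctx_bind:
  "fresh_for x \<theta> \<Longrightarrow>
   {(SVar x, \<alpha>)} \<oplus> subst_ctx \<theta> \<oplus> \<Theta> = subst_ctx \<theta> \<oplus> {(SVar x, \<alpha>)} \<oplus> \<Theta>"
  by (auto simp: fresh_for_def oplus_def subst_ctx_def sdom_def)

lemma subst_ctx_singleton: "subst_ctx {(x, M, \<alpha>)} = {(SVar x, \<alpha>)}"
  by (auto simp: subst_ctx_def)

text \<open>Freshness keeps \<open>x\<close> out of the terms in the range, so their typings survive
  weakening by \<open>x\<close>.\<close>

lemma arity_preserving_bind:
  "arity_preserving \<Theta> \<theta> \<Longrightarrow> fresh_for x \<theta> \<Longrightarrow> arity_preserving ({(SVar x, \<alpha>)} \<oplus> \<Theta>) \<theta>"
  by (force simp: arity_preserving_def fresh_for_def fv_rng_def intro: check_weaken)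

text \<open>The conjunct \<open>size \<alpha> \<le> n\<close> strengthens the claim: when the head
  has been replaced, it bounds the arity type of the function part, so that the redex falls under
  the outer hypothesis.\<close>

lemma hsub_exists_bounded:
  fixes M :: "'c ctm" and R :: "'c atm"
  assumes "finite \<theta>" "arity_preserving \<Theta> \<theta>" "\<forall>(x, N, \<beta>) \<in> \<theta>. size \<beta> \<le> n"
  shows "(check (subst_ctx \<theta> \<oplus> \<Theta>) M \<alpha> \<longrightarrow> (\<exists>M'. hsub \<theta> M M' \<and> check \<Theta> M' \<alpha>)) \<and>
    (synth (subst_ctx \<theta> \<oplus> \<Theta>) R \<alpha> \<longrightarrow>
      (\<exists>R'. hsub_rr \<theta> R R' \<and> synth \<Theta> R' \<alpha>) \<or>
      (\<exists>M. hsub_rm \<theta> R M \<alpha> \<and> check \<Theta> M \<alpha> \<and> size \<alpha> \<le> n))"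
  using assms
proof (induction n arbitrary: \<theta> \<Theta> M R \<alpha> rule: less_induct)
  case (less n)
  note outer = less.IH
  \<comment> \<open>One bound \<open>k\<close> serves both term classes, so either half may call the
    other on smaller terms. The strict inequality makes \<open>k = 0\<close> vacuous.\<close>
  have "(size M < k \<longrightarrow> check (subst_ctx \<theta> \<oplus> \<Theta>) M \<alpha> \<longrightarrow>
      (\<exists>M'. hsub \<theta> M M' \<and> check \<Theta> M' \<alpha>)) \<and>
    (size R < k \<longrightarrow> synth (subst_ctx \<theta> \<oplus> \<Theta>) R \<alpha> \<longrightarrow>
      (\<exists>R'. hsub_rr \<theta> R R' \<and> synth \<Theta> R' \<alpha>) \<or>
      (\<exists>M. hsub_rm \<theta> R M \<alpha> \<and> check \<Theta> M \<alpha> \<and> size \<alpha> \<le> n))" for k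
    using less.prems
  proof (induction k arbitrary: \<Theta> M R \<alpha>)
    case 0
    then show ?case by simp
  next
    case (Suc k)
    note fin = \<open>finite \<theta>\<close> and ap = \<open>arity_preserving \<Theta> \<theta>\<close> and bd = Suc.prems(3)
    note IHc = Suc.IH[OF fin _ bd, THEN conjunct1, rule_format]
    note IHs = Suc.IH[OF fin _ bd, THEN conjunct2, rule_format]
    show ?case
    proof (intro conjI impI)
      assume sz: "size M < Suc k" and ty: "check (subst_ctx \<theta> \<oplus> \<Theta>) M \<alpha>"
      show "\<exists>M'. hsub \<theta> M M' \<and> check \<Theta> M' \<alpha>"
      proof (cases M)
        case (Atm R)
        \<comment> \<open>The abstraction rule is excluded because \<open>lam\<close> unfolds to
          \<open>Lam\<close>; atomic terms are checked only at the base arity type.\<close>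
        from ty have "synth (subst_ctx \<theta> \<oplus> \<Theta>) R \<o>" and "\<alpha> = \<o>"
          by (cases; simp add: Atm lam_def)+
        moreover have "size R < k"
          using sz Atm by simp
        ultimately show ?thesis
          using IHs[OF ap, of R \<o>] unfolding Atm
          by (blast intro: hsub_Atm_r hsub_Atm_m check_Atm)
      next
        case (Lam N)
        obtain x M\<^sub>0 \<alpha>\<^sub>1 \<alpha>\<^sub>2 where x: "x \<notin> sdom \<theta> \<union> fv_rng \<theta>" and M: "Lam N = lam x M\<^sub>0"
          and \<alpha>: "\<alpha> = \<alpha>\<^sub>1 \<rightarrow> \<alpha>\<^sub>2"
          and M\<^sub>0: "check ({(SVar x, \<alpha>\<^sub>1)} \<oplus> subst_ctx \<theta> \<oplus> \<Theta>) M\<^sub>0 \<alpha>\<^sub>2"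
          using check_Lam_fresh[OF ty[unfolded Lam] finite_sdom_fv_rng[OF fin]] .
        have fresh: "fresh_for x \<theta>"
          using x by (simp add: fresh_for_def)
        have "size M\<^sub>0 < k"
          using sz M Lam by (simp add: lam_def)
        then obtain M' where "hsub \<theta> M\<^sub>0 M'" "check ({(SVar x, \<alpha>\<^sub>1)} \<oplus> \<Theta>) M' \<alpha>\<^sub>2"
          using IHc[OF arity_preserving_bind[OF ap fresh]] M\<^sub>0 subst_ctx_bind[OF fresh] by metis
        then show ?thesis
          using fresh unfolding Lam M \<alpha> by (blast intro: hsub_lam check_lam)
      qed
    next
      assume sz: "size R < Suc k" and ty: "synth (subst_ctx \<theta> \<oplus> \<Theta>) R \<alpha>"
      let ?rr = "\<exists>R'. hsub_rr \<theta> R R' \<and> synth \<Theta> R' \<alpha>"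
      let ?rm = "\<exists>M. hsub_rm \<theta> R M \<alpha> \<and> check \<Theta> M \<alpha> \<and> size \<alpha> \<le> n"
      from ty show "?rr \<or> ?rm"
      proof cases
        case (synth_Con c)
        \<comment> \<open>The context of \<theta> assigns variables only, so a constant gets its
          arity type from \<Theta>.\<close>
        then have "(SCon c, \<alpha>) \<in> \<Theta>"
          by (auto simp: oplus_def subst_ctx_def)
        then show ?thesis
          using synth_Con by (blast intro: hsub_rr_Con synth_check.synth_Con)
      next
        case (synth_Var x)
        show ?thesis
        proof (cases "x \<in> sdom \<theta>")
          case True
          \<comment> \<open>Assignments from \<theta> shadow those of \<Theta>, so \<alpha> is an
            arity type recorded in \<theta> and its size is at most \<open>n\<close>.\<close>
          then obtain M where "(x, M, \<alpha>) \<in> \<theta>"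
            using synth_Var by (auto simp: oplus_def Domain_subst_ctx) (auto simp: subst_ctx_def)
          then show ?thesis
            using ap bd synth_Var by (auto simp: arity_preserving_def intro: hsub_rm_Var)
        next
          case False
          then have "(SVar x, \<alpha>) \<in> \<Theta>"
            using synth_Var by (auto simp: oplus_def subst_ctx_def sdom_def)
          then show ?thesis
            using False synth_Var by (blast intro: hsub_rr_Var synth_check.synth_Var)
        qed
      next
        case (synth_App R\<^sub>0 \<alpha>' M)
        have "size R\<^sub>0 < k" "size M < k"
          using sz synth_App by simp_all
        then obtain M'' where M'': "hsub \<theta> M M''" "check \<Theta> M'' \<alpha>'"
          using IHc[OF ap] synth_App by blast
        from IHs[OF ap \<open>size R\<^sub>0 < k\<close> synth_App(2)] show ?thesis
        proof (elim disjE exE conjE)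
          fix R' assume "hsub_rr \<theta> R\<^sub>0 R'" "synth \<Theta> R' (\<alpha>' \<rightarrow> \<alpha>)"
          then show ?thesis
            using M'' synth_App by (blast intro: hsub_rr_App synth_check.synth_App)
        next
          fix L assume L: "hsub_rm \<theta> R\<^sub>0 L (\<alpha>' \<rightarrow> \<alpha>)" "check \<Theta> L (\<alpha>' \<rightarrow> \<alpha>)"
            and le: "size (\<alpha>' \<rightarrow> \<alpha>) \<le> n"
          \<comment> \<open>A canonical term of arrow arity type can only be an abstraction, which
            is what \<open>hsub_rm_App\<close> asks of the replaced function part.\<close>
          from L(2) obtain x M' where M': "L = lam x M'" "check ({(SVar x, \<alpha>')} \<oplus> \<Theta>) M' \<alpha>"
            by cases auto
          have "arity_preserving \<Theta> {(x, M'', \<alpha>')}"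
            using M'' by (simp add: arity_preserving_def)
          \<comment> \<open>The new bound is \<open>size \<alpha>'\<close>, strictly below
            \<open>size (\<alpha>' \<rightarrow> \<alpha>)\<close> and so below \<open>n\<close>. It
            alone drives this call: the body \<open>M'\<close> may be larger than the original
            term.\<close>
          then obtain M''' where M''': "hsub {(x, M'', \<alpha>')} M' M'''" "check \<Theta> M''' \<alpha>"
            using outer[of "size \<alpha>'" "{(x, M'', \<alpha>')}" \<Theta> M' \<alpha>] M'(2) le
            by (auto simp: subst_ctx_singleton)
          then have "hsub_rm \<theta> R M''' \<alpha>"
            using L(1) M'(1) M''(1) synth_App(1) by (blast intro: hsub_rm_App)
          then show ?thesis
            using M'''(2) le by auto
        qed
      qed
    qed
  qed
  \<comment> \<open>This bound exceeds both sizes and so discharges both guards.\<close>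
  from this[of "Suc (size M + size R)"] show ?case
    by simp
qed

lemma hsub_exists:
  assumes "finite \<theta>" "arity_preserving \<Theta> \<theta>"
  shows "check (subst_ctx \<theta> \<oplus> \<Theta>) M \<alpha> \<Longrightarrow> \<exists>M'. hsub \<theta> M M' \<and> check \<Theta> M' \<alpha>"
    and "synth (subst_ctx \<theta> \<oplus> \<Theta>) R \<alpha> \<Longrightarrow>
      (\<exists>R'. hsub_rr \<theta> R R' \<and> synth \<Theta> R' \<alpha>) \<or> (\<exists>M. hsub_rm \<theta> R M \<alpha> \<and> check \<Theta> M \<alpha>)"
proof -
  \<comment> \<open>Finiteness supplies a bound. A sum, unlike a maximum, needs no separate case for
    the empty substitution.\<close>
  have "\<forall>(x, N, \<beta>) \<in> \<theta>. size \<beta> \<le> (\<Sum>(x, N, \<beta>) \<in> \<theta>. size \<beta>)"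
    using member_le_sum[OF _ _ assms(1), of _ "\<lambda>(x, N, \<beta>). size \<beta>"] by fastforce
  note * = hsub_exists_bounded[OF assms this]
  show "check (subst_ctx \<theta> \<oplus> \<Theta>) M \<alpha> \<Longrightarrow> \<exists>M'. hsub \<theta> M M' \<and> check \<Theta> M' \<alpha>"
    using * by blast
  show "synth (subst_ctx \<theta> \<oplus> \<Theta>) R \<alpha> \<Longrightarrow>
      (\<exists>R'. hsub_rr \<theta> R R' \<and> synth \<Theta> R' \<alpha>) \<or> (\<exists>M. hsub_rm \<theta> R M \<alpha> \<and> check \<Theta> M \<alpha>)"
    using * by blast
qed

section \<open>Hereditary substitution on types and kinds\<close>

text \<open>Substitution acts only on terms inside atomic types and leaves the Pi skeleton alone.
  Hence the codomain keeps the same arity type for its bound variable.\<close>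

lemma hsub_ty_erase: "hsub_ty \<theta> A A' \<Longrightarrow> erase A' = erase A"
  by (induction rule: hsub_ty.induct) (auto simp: tpi_def)

lemma hsub_aty_exists:
  assumes "finite \<theta>" "arity_preserving \<Theta> \<theta>"
  shows "\<forall>M \<in> args P. \<exists>\<alpha>. check (subst_ctx \<theta> \<oplus> \<Theta>) M \<alpha> \<Longrightarrow>
    \<exists>P'. hsub_aty \<theta> P P' \<and> (\<forall>M \<in> args P'. \<exists>\<alpha>. check \<Theta> M \<alpha>)"
proof (induction P)
  case (TCon a)
  show ?case
    by (rule exI[of _ "TCon a"]) (simp add: hsub_TCon)
next
  case (TApp P M)
  then obtain P' where P': "hsub_aty \<theta> P P'" "\<forall>M \<in> args P'. \<exists>\<alpha>. check \<Theta> M \<alpha>"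
    by auto
  obtain M' \<alpha> where M': "hsub \<theta> M M'" "check \<Theta> M' \<alpha>"
    using TApp.prems hsub_exists(1)[OF assms] by auto blast
  show ?case
    by (rule exI[of _ "TApp P' M'"]) (use P' M' in \<open>auto intro: hsub_TApp\<close>)
qed

text \<open>Induction on size, because the codomain comes back from inversion under a fresh name.
  \<Theta> is general since it grows at each binder.\<close>

lemma hsub_ty_exists:
  assumes "finite \<theta>"
  shows "arity_preserving \<Theta> \<theta> \<Longrightarrow> respects_ty (subst_ctx \<theta> \<oplus> \<Theta>) A \<Longrightarrow>
    \<exists>A'. respects_ty \<Theta> A' \<and> hsub_ty \<theta> A A'"
proof (induction "size A" arbitrary: A \<Theta> rule: less_induct)
  case less
  show ?case
  proof (cases A)
    case (ATy P)
    have "\<forall>M \<in> args P. \<exists>\<alpha>. check (subst_ctx \<theta> \<oplus> \<Theta>) M \<alpha>"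
      using less.prems(2) by cases (simp_all add: ATy tpi_def)
    from hsub_aty_exists[OF assms less.prems(1) this] show ?thesis
      unfolding ATy by (blast intro: hsub_ATy respects_ATy)
  next
    case (Pi A\<^sub>1 C)
    obtain x B where x: "x \<notin> sdom \<theta> \<union> fv_rng \<theta>" and A: "Pi A\<^sub>1 C = tpi x A\<^sub>1 B"
      and A\<^sub>1: "respects_ty (subst_ctx \<theta> \<oplus> \<Theta>) A\<^sub>1"
      and B: "respects_ty ({(SVar x, erase A\<^sub>1)} \<oplus> subst_ctx \<theta> \<oplus> \<Theta>) B"
      using respects_Pi_fresh[OF less.prems(2)[unfolded Pi] finite_sdom_fv_rng[OF assms]] .
    have fresh: "fresh_for x \<theta>"
      using x by (simp add: fresh_for_def)
    have "size A\<^sub>1 < size A" "size B < size A"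
      using Pi A by (simp_all add: tpi_def)
    obtain A' where A': "respects_ty \<Theta> A'" "hsub_ty \<theta> A\<^sub>1 A'"
      using less.hyps[OF \<open>size A\<^sub>1 < size A\<close> less.prems(1) A\<^sub>1] by blast
    obtain B' where "respects_ty ({(SVar x, erase A\<^sub>1)} \<oplus> \<Theta>) B'" "hsub_ty \<theta> B B'"
      using less.hyps[OF \<open>size B < size A\<close> arity_preserving_bind[OF less.prems(1) fresh]]
        B subst_ctx_bind[OF fresh] by metis
    \<comment> \<open>The codomain respects the context with \<open>erase A\<^sub>1\<close>, while
      the rule wants \<open>erase A'\<close>; \<open>hsub_ty_erase\<close> equates the two.\<close>
    then have "respects_ty \<Theta> (tpi x A' B')" "hsub_ty \<theta> (tpi x A\<^sub>1 B) (tpi x A' B')"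
      using A' fresh by (auto simp: hsub_ty_erase intro: respects_pi hsub_pi)
    then show ?thesis
      unfolding Pi A by blast
  qed
qed

text \<open>Follows the pattern for types. The domain of a product kind is a type and is settled by
  \<open>hsub_ty_exists\<close>; only the body needs the induction hypothesis.\<close>

lemma hsub_kind_exists:
  assumes "finite \<theta>"
  shows "arity_preserving \<Theta> \<theta> \<Longrightarrow> respects_kind (subst_ctx \<theta> \<oplus> \<Theta>) K \<Longrightarrow>
    \<exists>K'. respects_kind \<Theta> K' \<and> hsub_kind \<theta> K K'"
proof (induction "size K" arbitrary: K \<Theta> rule: less_induct)
  case less
  show ?case
  proof (cases K)
    case Type
    then show ?thesis
      by (blast intro: respects_Type hsub_Type)
  next
    case (KPi A C)
    obtain x L where x: "x \<notin> sdom \<theta> \<union> fv_rng \<theta>" and K: "KPi A C = kpi x A L"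
      and A: "respects_ty (subst_ctx \<theta> \<oplus> \<Theta>) A"
      and L: "respects_kind ({(SVar x, erase A)} \<oplus> subst_ctx \<theta> \<oplus> \<Theta>) L"
      using respects_KPi_fresh[OF less.prems(2)[unfolded KPi] finite_sdom_fv_rng[OF assms]] .
    have fresh: "fresh_for x \<theta>"
      using x by (simp add: fresh_for_def)
    have "size L < size K"
      using KPi K by (simp add: kpi_def)
    obtain A' where A': "respects_ty \<Theta> A'" "hsub_ty \<theta> A A'"
      using hsub_ty_exists[OF assms less.prems(1) A] by blast
    obtain L' where "respects_kind ({(SVar x, erase A)} \<oplus> \<Theta>) L'" "hsub_kind \<theta> L L'"
      using less.hyps[OF \<open>size L < size K\<close> arity_preserving_bind[OF less.prems(1) fresh]]
        L subst_ctx_bind[OF fresh] by metis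
    then have "respects_kind \<Theta> (kpi x A' L')" "hsub_kind \<theta> (kpi x A L) (kpi x A' L')"
      using A' fresh by (auto simp: hsub_ty_erase intro: respects_kpi hsub_kpi)
    then show ?thesis
      unfolding KPi K by blast
  qed
qed

theorem theorem2p8:
  fixes \<theta> :: "'c subst" and \<Theta> \<Theta>' :: "'c actx"
  assumes "is_subst \<theta>"
    and "arity_ctx \<Theta>"
    and "arity_preserving \<Theta> \<theta>"
    and "\<Theta>' = subst_ctx \<theta> \<oplus> \<Theta>"
  shows "(\<forall>E :: ('a, 'c) cty. respects_ty \<Theta>' E \<longrightarrow> (\<exists>E'. respects_ty \<Theta> E' \<and> hsub_ty \<theta> E E'))
    \<and> (\<forall>E :: ('a, 'c) kind. respects_kind \<Theta>' E \<longrightarrow> (\<exists>E'. respects_kind \<Theta> E' \<and> hsub_kind \<theta> E E'))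
    \<and> (\<forall>M \<alpha>. check \<Theta>' M \<alpha> \<longrightarrow> (\<exists>M'. hsub \<theta> M M' \<and> check \<Theta> M' \<alpha>))
    \<and> (\<forall>R \<alpha>. synth \<Theta>' R \<alpha> \<longrightarrow>
          (\<exists>R'. hsub_rr \<theta> R R' \<and> synth \<Theta> R' \<alpha>)
        \<or> (\<exists>M. hsub_rm \<theta> R M \<alpha> \<and> check \<Theta> M \<alpha>))"
proof -
  have "finite \<theta>"
    using assms(1) by (simp add: is_subst_def)
  note hsub_ty_exists[OF this assms(3)] hsub_kind_exists[OF this assms(3)]
    hsub_exists[OF this assms(3)]
  then show ?thesis
    unfolding assms(4) by blast
qed

end
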